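(* Suppose that the function $f:\mathbb{R}^{2}\to\mathbb{R}$ is in both of the classes $RI(\mathbb{R}^{2})$ and $RpI(\mathbb{R}^{2})$. Then $$\int_{\mathbb{R}^{2}}f=\mathcal{R}_{1,1}\int f .$$
   Context: For $m\in\mathbb{N}=\{1,2,\dots\}$ and an integer $k\ge 0$, $D_{k}(\mathbb{R}^{m})$ is the collection of all semiclosed dyadic cubes $\prod_{j=1}^{m}[n_{j}2^{-k},(n_{j}+1)2^{-k})$ with $n_{1},\dots,n_{m}\in\mathbb{Z}$. $BB(\mathbb{R}^{m})$ is the set of bounded functions $f:\mathbb{R}^{m}\to\mathbb{R}$ which vanish outside some bounded set. For $f\in BB(\mathbb{R}^{m})$ set $U_{k}(f)=2^{-km}\sum_{I\in D_{k}(\mathbb{R}^{m})}\sup_{p\in I}f(p)$ and $L_{k}(f)=2^{-km}\sum_{I\in D_{k}(\mathbb{R}^{m})}\inf_{p\in I}f(p)$ (only finitely many terms are non-zero). The sequences $U_k(f)$ and $L_k(f)$ are bounded and, respectively, non-increasing and non-decreasing in $k$, so they converge. A function $f\in BB(\mathbb{R}^{m})$ is (dyadically) Riemann integrable, written $f\in RI(\mathbb{R}^{m})$, if $\lim_{k\to\infty}U_{k}(f)=\lim_{k\to\infty}L_{k}(f)$; the common value is denoted $\int_{\mathbb{R}^{m}}f$. Repeated integrals: $RpI(\mathbb{R}^{2})$ is the set of all $f\in BB(\mathbb{R}^{2})$ such that (i) for each $x\in\mathbb{R}$ the function $f_{x}:\mathbb{R}\to\mathbb{R}$, $f_{x}(t)=f(x,t)$,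 is in $RI(\mathbb{R})$; and (ii) the function $g_{f}:\mathbb{R}\to\mathbb{R}$, $g_{f}(x)=\int_{\mathbb{R}}f_{x}$, is in $RI(\mathbb{R})$. For $f\in RpI(\mathbb{R}^{2})$ one defines $\mathcal{R}_{1,1}\int f=\int_{\mathbb{R}}g_{f}$. *)

theory Defs
  imports "HOL-Analysis.Analysis"
begin

text \<open>
  The space \<open>\<real>\<^sup>m\<close> is rendered as an arbitrary Euclidean space \<open>'a\<close> with \<open>DIM('a) = m\<close>; the
  coordinates of \<open>x\<close> are \<open>x \<bullet> b\<close> for \<open>b \<in> Basis\<close>. The line is \<^typ>\<open>real\<close> (with basis \<open>{1}\<close>) and
  the plane is \<^typ>\<open>real \<times> real\<close> (with basis \<open>{(1, 0), (0, 1)}\<close>).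
\<close>

text \<open>The values of \<open>n\<close> outside \<open>Basis\<close> are irrelevant.\<close>

definition dyadic_cube :: "nat \<Rightarrow> ('a \<Rightarrow> int) \<Rightarrow> 'a::euclidean_space set" where
  "dyadic_cube k n =
     {x. \<forall>b\<in>Basis. of_int (n b) / 2 ^ k \<le> x \<bullet> b \<and> x \<bullet> b < (of_int (n b) + 1) / 2 ^ k}"

definition dyadic_cubes :: "nat \<Rightarrow> 'a::euclidean_space set set" where
  "dyadic_cubes k = range (dyadic_cube k)"

definition BB :: "('a::euclidean_space \<Rightarrow> real) set" where
  "BB = {f. bounded (range f) \<and> (\<exists>B. bounded B \<and> (\<forall>x. x \<notin> B \<longrightarrow> f x = 0))}"

text \<open>For \<open>f \<in> BB\<close> only finitely many terms of the following sums are non-zero.\<close>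

definition upper_dyadic_sum :: "nat \<Rightarrow> ('a::euclidean_space \<Rightarrow> real) \<Rightarrow> real" where
  "upper_dyadic_sum k f =
     (1 / 2 ^ (k * DIM('a))) * (\<Sum>\<^sub>\<infinity>I\<in>dyadic_cubes k. (SUP p\<in>I. f p))"

definition lower_dyadic_sum :: "nat \<Rightarrow> ('a::euclidean_space \<Rightarrow> real) \<Rightarrow> real" where
  "lower_dyadic_sum k f =
     (1 / 2 ^ (k * DIM('a))) * (\<Sum>\<^sub>\<infinity>I\<in>dyadic_cubes k. (INF p\<in>I. f p))"

text \<open>For \<open>f \<in> BB\<close> both sequences are monotone and bounded, hence convergent, so the existential
  below says exactly that their two limits coincide.\<close>

definition RI :: "('a::euclidean_space \<Rightarrow> real) set" where
  "RI = {f \<in> BB. \<exists>c. (\<lambda>k. upper_dyadic_sum k f) \<longlonglongrightarrow> c \<and> (\<lambda>k. lower_dyadic_sum k f) \<longlonglongrightarrow> c}"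

text \<open>Meaningful for \<open>f \<in> RI\<close>, where the lower sums have the same limit.\<close>

definition dyadic_integral :: "('a::euclidean_space \<Rightarrow> real) \<Rightarrow> real" where
  "dyadic_integral f = lim (\<lambda>k. upper_dyadic_sum k f)"

definition slice_integral :: "(real \<times> real \<Rightarrow> real) \<Rightarrow> real \<Rightarrow> real" where
  "slice_integral f x = dyadic_integral (\<lambda>t. f (x, t))"

definition RpI :: "(real \<times> real \<Rightarrow> real) set" where
  "RpI = {f \<in> BB. (\<forall>x. (\<lambda>t. f (x, t)) \<in> RI) \<and> slice_integral f \<in> RI}"

definition repeated_integral :: "(real \<times> real \<Rightarrow> real) \<Rightarrow> real" where
  "repeated_integral f = dyadic_integral (slice_integral f)"

end

theory Submission
  imports Defs
begin

text \<open>
  The point is that taking slice integrals does not increase upper sums. Let \<open>g\<close> be the slice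
  integral of \<open>f\<close>. If \<open>x\<close> lies in a dyadic interval \<open>I\<close> of level \<open>k\<close>, then
  \<open>g x\<close> is at most the \<open>k\<close>-th upper sum of the slice \<open>f (x, _)\<close>, because upper sums only decrease
  under refinement; and that sum is at most \<open>2\<^sup>-\<^sup>k\<close> times the sum over the intervals \<open>J\<close> of
  the suprema of \<open>f\<close> on the squares \<open>I \<times> J\<close>. The last bound depends only on \<open>I\<close>, so it also
  bounds the supremum of \<open>g\<close> on \<open>I\<close>, and summing over \<open>I\<close> gives the inequality
  \<open>upper_dyadic_sum k g \<le> upper_dyadic_sum k f\<close>
  (lemma \<open>upper_dyadic_sum_slice_integral_le\<close>).

  Lower sums are the negatives of the upper sums of \<open>- f\<close>, and integrability of the slices
  makes \<open>- g\<close> the slice integral of \<open>- f\<close>. So the same lemma for \<open>- f\<close> shows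
  that the lower sums of \<open>g\<close> are at least those of \<open>f\<close>. As \<open>k\<close> grows, the upper
  inequality shows that the integral of \<open>g\<close> is at most that of \<open>f\<close>, and the lower one that it is
  at least that of \<open>f\<close>.
\<close>

section \<open>Dyadic intervals and squares\<close>

definition dyadic_interval :: "nat \<Rightarrow> int \<Rightarrow> real set" where
  "dyadic_interval k n = {of_int n / 2 ^ k..<(of_int n + 1) / 2 ^ k}"

lemma left_endpoint_in_dyadic_interval: "of_int n / 2 ^ k \<in> dyadic_interval k n"
  by (simp add: dyadic_interval_def divide_strict_right_mono)

lemma dyadic_interval_nonempty: "dyadic_interval k n \<noteq> {}"
  using left_endpoint_in_dyadic_interval by blast

lemma index_eq_floor_if_in_dyadic_interval:
  assumes "x \<in> dyadic_interval k n"
  shows "n = \<lfloor>x * 2 ^ k\<rfloor>"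
proof -
  have "of_int n \<le> x * 2 ^ k" "x * 2 ^ k < of_int n + 1"
    using assms by (simp_all add: dyadic_interval_def field_simps)
  then show ?thesis by linarith
qed

lemma inj_dyadic_interval: "inj (dyadic_interval k)"
  by (metis injI index_eq_floor_if_in_dyadic_interval left_endpoint_in_dyadic_interval)

lemma dyadic_interval_Suc_subset: "dyadic_interval (Suc k) n \<subseteq> dyadic_interval k (n div 2)"
proof
  fix x assume x: "x \<in> dyadic_interval (Suc k) n"
  have "2 * (n div 2) \<le> n" "n + 1 \<le> 2 * (n div 2) + 2" by linarith+
  then have "2 * real_of_int (n div 2) \<le> of_int n"
    "of_int n + 1 \<le> 2 * real_of_int (n div 2) + 2" by linarith+
  moreover have "of_int n \<le> 2 * (x * 2 ^ k)" "2 * (x * 2 ^ k) < of_int n + 1"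
    using x by (simp_all add: dyadic_interval_def field_simps)
  ultimately have "of_int (n div 2) \<le> x * 2 ^ k" "x * 2 ^ k < of_int (n div 2) + 1"
    by linarith+
  then show "x \<in> dyadic_interval k (n div 2)"
    by (simp add: dyadic_interval_def field_simps)
qed

lemma dyadic_cubes_real: "dyadic_cubes k = range (dyadic_interval k)"
proof -
  have cube: "dyadic_cube k n = dyadic_interval k (n 1)" for n :: "real \<Rightarrow> int"
    by (auto simp: dyadic_cube_def dyadic_interval_def)
  have "dyadic_interval k n \<in> range (dyadic_cube k)" for n
    using cube[of "\<lambda>_. n"] by (metis rangeI)
  then show ?thesis
    unfolding dyadic_cubes_def using cube by auto
qed

lemma dyadic_cubes_plane:
  "dyadic_cubes k = range (\<lambda>(i, j). dyadic_interval k i \<times> dyadic_interval k j)"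
proof -
  have cube: "dyadic_cube k n = dyadic_interval k (n (1, 0)) \<times> dyadic_interval k (n (0, 1))"
    for n :: "real \<times> real \<Rightarrow> int"
    by (auto simp: dyadic_cube_def dyadic_interval_def Basis_prod_def)
  have "dyadic_interval k i \<times> dyadic_interval k j \<in> range (dyadic_cube k)" for i j
    by (rule range_eqI[where x = "\<lambda>b. if b = (1, 0) then i else j"]) (simp add: cube)
  then show ?thesis
    unfolding dyadic_cubes_def using cube by auto
qed

lemma inj_dyadic_square:
  "inj (\<lambda>(i, j). dyadic_interval k i \<times> dyadic_interval k j)"
  by (auto simp: inj_on_def times_eq_iff dyadic_interval_nonempty inj_eq[OF inj_dyadic_interval])

section \<open>Upper sums as finite sums\<close>

text \<open>For a function that vanishes where \<open>\<bar>x\<bar> > M\<close>, only the indices in \<open>{-N..<N}\<close> can contribute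
  to the upper sum of level \<open>k\<close>.\<close>

lemma abs_gt_if_in_far_dyadic_interval:
  assumes "M * 2 ^ k < of_int N" "n \<notin> {-N..<N}" "x \<in> dyadic_interval k n"
  shows "M < \<bar>x\<bar>"
proof -
  have x: "of_int n \<le> x * 2 ^ k" "x * 2 ^ k < of_int n + 1"
    using assms(3) by (simp_all add: dyadic_interval_def field_simps)
  have "N \<le> n \<or> n + 1 \<le> - N" using assms(2) by auto
  then have "real_of_int N \<le> of_int n \<or> of_int n + 1 \<le> - real_of_int N" by linarith
  then have "M * 2 ^ k < \<bar>x * 2 ^ k\<bar>"
    using x assms(1) by linarith
  then show ?thesis by (simp add: abs_mult)
qed

lemma SUP_eq_zero_if_vanishing:
  fixes h :: "'a \<Rightarrow> real"
  assumes "A \<noteq> {}" "\<And>x. x \<in> A \<Longrightarrow> h x = 0"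
  shows "(SUP x\<in>A. h x) = 0"
  using assms by simp

lemma upper_dyadic_sum_real:
  fixes h :: "real \<Rightarrow> real"
  assumes "\<And>x. M < \<bar>x\<bar> \<Longrightarrow> h x = 0" "M * 2 ^ k < of_int N"
  shows "upper_dyadic_sum k h = (\<Sum>n\<in>{-N..<N}. SUP x\<in>dyadic_interval k n. h x) / 2 ^ k"
proof -
  have "(\<Sum>\<^sub>\<infinity>I\<in>dyadic_cubes k. SUP x\<in>I. h x) = (\<Sum>\<^sub>\<infinity>n. SUP x\<in>dyadic_interval k n. h x)"
    by (simp add: dyadic_cubes_real infsum_reindex[OF inj_dyadic_interval] o_def)
  also have "\<dots> = (\<Sum>\<^sub>\<infinity>n\<in>{-N..<N}. SUP x\<in>dyadic_interval k n. h x)"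
  proof (rule infsum_cong_neutral)
    fix n assume "n \<in> UNIV - {-N..<N}"
    then show "(SUP x\<in>dyadic_interval k n. h x) = 0"
      using assms abs_gt_if_in_far_dyadic_interval[OF assms(2)]
      by (intro SUP_eq_zero_if_vanishing dyadic_interval_nonempty) auto
  qed auto
  finally show ?thesis by (simp add: upper_dyadic_sum_def)
qed

text \<open>The sum is nested, with one factor \<open>1 / 2 ^ k\<close> for each variable, so that the inner sums
  can be compared with upper sums of slices.\<close>

lemma upper_dyadic_sum_plane:
  fixes f :: "real \<times> real \<Rightarrow> real"
  assumes "\<And>p. M < norm p \<Longrightarrow> f p = 0" "M * 2 ^ k < of_int N"
  shows "upper_dyadic_sum k f =
    (\<Sum>i\<in>{-N..<N}. (\<Sum>j\<in>{-N..<N}.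
        SUP p\<in>dyadic_interval k i \<times> dyadic_interval k j. f p) / 2 ^ k) / 2 ^ k"
proof -
  let ?S = "\<lambda>(i, j). SUP p\<in>dyadic_interval k i \<times> dyadic_interval k j. f p"
  have "(\<Sum>\<^sub>\<infinity>I\<in>dyadic_cubes k. SUP p\<in>I. f p) = (\<Sum>\<^sub>\<infinity>ij. ?S ij)"
    by (simp add: dyadic_cubes_plane infsum_reindex[OF inj_dyadic_square] o_def)
      (simp add: case_prod_unfold)
  also have "\<dots> = (\<Sum>\<^sub>\<infinity>ij\<in>{-N..<N} \<times> {-N..<N}. ?S ij)"
  proof (rule infsum_cong_neutral)
    fix ij assume "ij \<in> UNIV - {-N..<N} \<times> {-N..<N}"
    then obtain i j where ij: "ij = (i, j)" "i \<notin> {-N..<N} \<or> j \<notin> {-N..<N}"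
      by (cases ij) auto
    have "f (x, y) = 0" if "x \<in> dyadic_interval k i" "y \<in> dyadic_interval k j" for x y
    proof -
      have "M < \<bar>x\<bar> \<or> M < \<bar>y\<bar>"
        using ij(2) that abs_gt_if_in_far_dyadic_interval[OF assms(2)] by blast
      then have "M < norm (x, y)"
        using norm_fst_le[of x y] norm_snd_le[of y x] by auto
      then show ?thesis by (rule assms(1))
    qed
    then show "?S ij = 0"
      unfolding ij(1) prod.case
      by (intro SUP_eq_zero_if_vanishing) (auto simp: dyadic_interval_nonempty)
  qed auto
  also have "\<dots> = (\<Sum>i\<in>{-N..<N}. \<Sum>j\<in>{-N..<N}. ?S (i, j))"
    by (simp add: sum.cartesian_product)
  finally show ?thesis
    by (simp add: upper_dyadic_sum_def mult_2_right power_add sum_divide_distrib)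
qed

section \<open>Functions that are bounded with bounded support\<close>

lemma BB_vanishes_far:
  assumes "f \<in> BB"
  obtains M where "\<And>x. M < norm x \<Longrightarrow> f x = 0"
proof -
  obtain B where "bounded B" "\<And>x. x \<notin> B \<Longrightarrow> f x = 0"
    using assms by (auto simp: BB_def)
  then show thesis
    using that unfolding bounded_iff by (metis linorder_not_less)
qed

lemma BB_bdd_above:
  assumes "f \<in> BB"
  shows "bdd_above (f ` A)"
proof -
  have "bounded (f ` A)"
    using assms by (auto simp: BB_def intro: bounded_subset)
  then show ?thesis by (rule bounded_imp_bdd_above)
qed

lemma BB_uminus:
  assumes "f \<in> BB"
  shows "(\<lambda>x. - f x) \<in> BB"
proof -
  have "bounded (uminus ` range f)"
    using assms by (simp add: BB_def)
  then show ?thesis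
    using assms by (simp add: BB_def image_image)
qed

lemma lower_dyadic_sum_eq_uminus_upper:
  "lower_dyadic_sum k f = - upper_dyadic_sum k (\<lambda>x. - f x)"
  by (simp add: lower_dyadic_sum_def upper_dyadic_sum_def Inf_real_def image_image infsum_uminus)

section \<open>The integral on the line\<close>

text \<open>Each interval of level \<open>k\<close> is the union of exactly two intervals of level \<open>Suc k\<close>, on
  each of which the supremum is no larger, while the weight is halved.\<close>

lemma upper_dyadic_sum_Suc_le:
  fixes h :: "real \<Rightarrow> real"
  assumes h: "h \<in> BB"
  shows "upper_dyadic_sum (Suc k) h \<le> upper_dyadic_sum k h"
proof -
  obtain M where M: "\<And>x. M < norm x \<Longrightarrow> h x = 0" using BB_vanishes_far[OF h] by blast
  obtain N :: int where N: "M * 2 ^ k < of_int N" using ex_less_of_int by blast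
  define s where "s l n = (SUP x\<in>dyadic_interval l n. h x)" for l n
  \<comment> \<open>The children of interval \<open>n\<close> are numbered \<open>2 * n\<close> and \<open>2 * n + 1\<close>.\<close>
  have split: "{-(2 * N)..<2 * N} = (\<lambda>n. 2 * n) ` {-N..<N} \<union> (\<lambda>n. 2 * n + 1) ` {-N..<N}"
  proof (intro equalityI subsetI)
    fix n assume "n \<in> {-(2 * N)..<2 * N}"
    then have "n div 2 \<in> {-N..<N}" "n = 2 * (n div 2) \<or> n = 2 * (n div 2) + 1"
      by (simp; linarith)+
    then show "n \<in> (\<lambda>n. 2 * n) ` {-N..<N} \<union> (\<lambda>n. 2 * n + 1) ` {-N..<N}"
      by blast
  qed auto
  have disj: "(\<lambda>n::int. 2 * n) ` {-N..<N} \<inter> (\<lambda>n. 2 * n + 1) ` {-N..<N} = {}"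
    by (auto; presburger)
  have "(\<Sum>n\<in>{-(2 * N)..<2 * N}. s (Suc k) n) \<le> (\<Sum>n\<in>{-(2 * N)..<2 * N}. s k (n div 2))"
    unfolding s_def
    by (intro sum_mono cSUP_subset_mono dyadic_interval_nonempty BB_bdd_above h
        dyadic_interval_Suc_subset order_refl)
  also have "\<dots> = 2 * (\<Sum>n\<in>{-N..<N}. s k n)"
    by (simp add: split disj sum.union_disjoint sum.reindex inj_on_def)
  finally have "(\<Sum>n\<in>{-(2 * N)..<2 * N}. s (Suc k) n) / 2 ^ Suc k \<le> (\<Sum>n\<in>{-N..<N}. s k n) / 2 ^ k"
    by (simp add: field_simps)
  moreover have "M * 2 ^ Suc k < of_int (2 * N)" using N by simp
  ultimately show ?thesis
    using upper_dyadic_sum_real[of M h k N] upper_dyadic_sum_real[of M h "Suc k" "2 * N"] M N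
    by (simp add: s_def)
qed

lemma RI_limits:
  assumes "f \<in> RI"
  shows "(\<lambda>k. upper_dyadic_sum k f) \<longlonglongrightarrow> dyadic_integral f"
    and "(\<lambda>k. lower_dyadic_sum k f) \<longlonglongrightarrow> dyadic_integral f"
proof -
  obtain c where c: "(\<lambda>k. upper_dyadic_sum k f) \<longlonglongrightarrow> c" "(\<lambda>k. lower_dyadic_sum k f) \<longlonglongrightarrow> c"
    using assms by (auto simp: RI_def)
  moreover have "dyadic_integral f = c"
    unfolding dyadic_integral_def using c(1) by (rule limI)
  ultimately show "(\<lambda>k. upper_dyadic_sum k f) \<longlonglongrightarrow> dyadic_integral f"
    and "(\<lambda>k. lower_dyadic_sum k f) \<longlonglongrightarrow> dyadic_integral f"
    by simp_all
qed

lemma dyadic_integral_le_upper_dyadic_sum: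
  fixes h :: "real \<Rightarrow> real"
  assumes h: "h \<in> RI"
  shows "dyadic_integral h \<le> upper_dyadic_sum k h"
proof -
  have "decseq (\<lambda>k. upper_dyadic_sum k h)"
    using h by (intro decseq_SucI upper_dyadic_sum_Suc_le) (simp add: RI_def)
  then show ?thesis
    using RI_limits(1)[OF h] by (rule decseq_ge)
qed

lemma RI_uminus:
  assumes "f \<in> RI"
  shows "(\<lambda>x. - f x) \<in> RI" and "dyadic_integral (\<lambda>x. - f x) = - dyadic_integral f"
proof -
  have upper: "(\<lambda>k. upper_dyadic_sum k (\<lambda>x. - f x)) \<longlonglongrightarrow> - dyadic_integral f"
    using tendsto_minus[OF RI_limits(2)[OF assms]]
    by (simp add: lower_dyadic_sum_eq_uminus_upper)
  have lower: "(\<lambda>k. lower_dyadic_sum k (\<lambda>x. - f x)) \<longlonglongrightarrow> - dyadic_integral f"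
    using tendsto_minus[OF RI_limits(1)[OF assms]]
    by (simp add: lower_dyadic_sum_eq_uminus_upper)
  show "(\<lambda>x. - f x) \<in> RI"
    using upper lower assms BB_uminus by (auto simp: RI_def)
  show "dyadic_integral (\<lambda>x. - f x) = - dyadic_integral f"
    unfolding dyadic_integral_def[of "\<lambda>x. - f x"] using upper by (rule limI)
qed

section \<open>Slice integrals and the repeated integral\<close>

lemma RpI_uminus:
  assumes "f \<in> RpI"
  shows "(\<lambda>p. - f p) \<in> RpI" and "slice_integral (\<lambda>p. - f p) = (\<lambda>x. - slice_integral f x)"
proof -
  show slice: "slice_integral (\<lambda>p. - f p) = (\<lambda>x. - slice_integral f x)"
    using assms by (auto simp: slice_integral_def RpI_def RI_uminus(2))
  show "(\<lambda>p. - f p) \<in> RpI"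
    using assms by (simp add: RpI_def slice RI_uminus(1) BB_uminus)
qed

lemma upper_dyadic_sum_slice_integral_le:
  assumes f: "f \<in> RpI"
  shows "upper_dyadic_sum k (slice_integral f) \<le> upper_dyadic_sum k f"
proof -
  have fBB: "f \<in> BB" and slices: "\<And>x. (\<lambda>t. f (x, t)) \<in> RI" and gBB: "slice_integral f \<in> BB"
    using f by (auto simp: RpI_def RI_def)
  obtain M1 where M1: "\<And>p. M1 < norm p \<Longrightarrow> f p = 0" using BB_vanishes_far[OF fBB] by blast
  obtain M2 where M2: "\<And>x. M2 < norm x \<Longrightarrow> slice_integral f x = 0"
    using BB_vanishes_far[OF gBB] by blast
  \<comment> \<open>One range of indices has to serve the plane, every slice and the slice integral.\<close>
  define M where "M = max M1 M2"
  obtain N :: int where N: "M * 2 ^ k < of_int N" using ex_less_of_int by blast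
  have far: "f p = 0" if "M < norm p" for p using that M1 by (simp add: M_def)
  define S where "S i j = (SUP p\<in>dyadic_interval k i \<times> dyadic_interval k j. f p)" for i j
  have slice_le: "slice_integral f x \<le> (\<Sum>j\<in>{-N..<N}. S i j) / 2 ^ k"
    if x: "x \<in> dyadic_interval k i" for x i
  proof -
    have "f (x, t) = 0" if "M < \<bar>t\<bar>" for t
      using that norm_snd_le[of t x] by (intro far) simp
    then have "upper_dyadic_sum k (\<lambda>t. f (x, t)) =
        (\<Sum>j\<in>{-N..<N}. SUP t\<in>dyadic_interval k j. f (x, t)) / 2 ^ k"
      using N by (rule upper_dyadic_sum_real)
    also have "\<dots> \<le> (\<Sum>j\<in>{-N..<N}. S i j) / 2 ^ k"
    proof (intro divide_right_mono sum_mono)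
      fix j
      show "(SUP t\<in>dyadic_interval k j. f (x, t)) \<le> S i j"
        unfolding S_def
        using x by (intro cSUP_least dyadic_interval_nonempty cSUP_upper BB_bdd_above fBB) simp
    qed simp
    finally show ?thesis
      using dyadic_integral_le_upper_dyadic_sum[OF slices[of x], of k]
      by (simp add: slice_integral_def)
  qed
  have "upper_dyadic_sum k (slice_integral f) =
      (\<Sum>i\<in>{-N..<N}. SUP x\<in>dyadic_interval k i. slice_integral f x) / 2 ^ k"
    using N by (intro upper_dyadic_sum_real[of M] M2) (simp_all add: M_def)
  also have "\<dots> \<le> (\<Sum>i\<in>{-N..<N}. (\<Sum>j\<in>{-N..<N}. S i j) / 2 ^ k) / 2 ^ k"
    by (intro divide_right_mono sum_mono cSUP_least dyadic_interval_nonempty slice_le) simp_all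
  also have "\<dots> = upper_dyadic_sum k f"
    unfolding S_def using upper_dyadic_sum_plane[OF far N] by simp
  finally show ?thesis .
qed

theorem theorem5p10:
  fixes f :: "real \<times> real \<Rightarrow> real"
  assumes "f \<in> RI" and "f \<in> RpI"
  shows "dyadic_integral f = repeated_integral f"
proof -
  have g: "slice_integral f \<in> RI" using assms(2) by (simp add: RpI_def)
  have "lower_dyadic_sum k f \<le> lower_dyadic_sum k (slice_integral f)" for k
    using upper_dyadic_sum_slice_integral_le[OF RpI_uminus(1)[OF assms(2)], of k]
    by (simp add: lower_dyadic_sum_eq_uminus_upper RpI_uminus(2)[OF assms(2)])
  then have "dyadic_integral f \<le> dyadic_integral (slice_integral f)"
    using RI_limits(2)[OF assms(1)] RI_limits(2)[OF g] by (blast intro: LIMSEQ_le)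
  moreover have "dyadic_integral (slice_integral f) \<le> dyadic_integral f"
    using RI_limits(1)[OF g] RI_limits(1)[OF assms(1)]
      upper_dyadic_sum_slice_integral_le[OF assms(2)] by (blast intro: LIMSEQ_le)
  ultimately show ?thesis by (simp add: repeated_integral_def)
qed

end
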